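(* Let $A, B$ be integers with $1 \leq A \leq B$. Let $\mathcal{P}$ be the set of Dyck paths whose down-run lengths avoid $\{Ar + B \mid r \geq 0\}$. Then $\mathcal{P}$ satisfies the grammatical equation $$\mathcal{P} \cup (U\mathcal{P})^{B-1} U D^B \mathcal{P} = \{\epsilon\} \cup \bigcup_{1 \leq k < A} (U\mathcal{P})^{k-1} U D^k \mathcal{P} \ \cup\ (U\mathcal{P})^A D^A \mathcal{P},$$ where $\epsilon$ is the empty path, and therefore $$P(z) + z^B P(z)^B = 1 + \sum_{1 \leq k < A} z^k P(z)^k + z^A P(z)^{A+1},$$ where $P(z)$ is the weight-enumerator of $\mathcal{P}$.
   Context: A Dyck path is a finite (possibly empty) word in the letters $U$ (standing for $+1$) and $D$ (standing for $-1$) whose partial sums are all nonnegative and whose total sum is $0$. A Dyck path of length $2n$ is said to have semilength $n$. A down-run of length $\ell$ is a block of $\ell$ consecutive $D$'s that is neither preceded nor followed by a $D$ (a maximal block of $D$'s). The down-run lengths of a path avoid a set $S$ if the path has no down-run whose length lies in $S$. A grammatical equation is an equality of sets of words over $\{U,D\}$, combined by concatenation: for languages $L, L'$, $LL'$ is the set of words $ww'$ with $w\in L$, $w'\in L'$; $L^k$ is the $k$-fold concatenation, $L^0=\{\epsilon\}$; $U$ and $D$ denote the one-letter languages. The weight-enumerator of $\mathcal{P}$ is the formal power series $P(z) = \sum_{n \geq 0} p_n z^n$, where $p_n$ is the number of paths of semilength $n$ in $\mathcal{P}$. *)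

theory Defs
  imports "HOL-Computational_Algebra.Formal_Power_Series"
begin

datatype step = U | D

type_synonym word = "step list"

fun step_val :: "step \<Rightarrow> int" where
  "step_val U = 1"
| "step_val D = -1"

definition height :: "word \<Rightarrow> int" where
  "height w = sum_list (map step_val w)"

definition dyck :: "word \<Rightarrow> bool" where
  "dyck w \<longleftrightarrow> (\<forall>i \<le> length w. 0 \<le> height (take i w)) \<and> height w = 0"

definition has_down_run :: "word \<Rightarrow> nat \<Rightarrow> bool" where
  "has_down_run w l \<longleftrightarrow> 1 \<le> l \<and>
     (\<exists>u v. w = u @ replicate l D @ v \<and> (u = [] \<or> last u \<noteq> D) \<and> (v = [] \<or> hd v \<noteq> D))"

definition dyck_avoiding :: "nat set \<Rightarrow> word set" where
  "dyck_avoiding S = {w. dyck w \<and> (\<forall>l. has_down_run w l \<longrightarrow> l \<notin> S)}"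

definition conc :: "word set \<Rightarrow> word set \<Rightarrow> word set"  (infixr "@@" 75) where
  "L @@ L' = {w @ w' | w w'. w \<in> L \<and> w' \<in> L'}"

primrec lang_pow :: "word set \<Rightarrow> nat \<Rightarrow> word set"  (infixr "^^^" 80) where
  "L ^^^ 0 = {[]}"
| "L ^^^ Suc k = L @@ L ^^^ k"

abbreviation UU :: "word set" where "UU \<equiv> {[U]}"
abbreviation DD :: "word set" where "DD \<equiv> {[D]}"

(* The words of a fixed length are finitely many, so card is a genuine count. *)
definition weight_enum :: "word set \<Rightarrow> int fps" where
  "weight_enum L = Abs_fps (\<lambda>n. int (card {w \<in> L. length w = 2 * n}))"

end

theory Submission
  imports Defs
begin

text \<open>
  Write \<open>arch k = (U P)\<^sup>k\<^sup>-\<^sup>1 U D\<^sup>k\<close>. Cutting a nonempty path of \<open>P\<close> after its first return to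
  the axis gives \<open>P = \<epsilon> \<union> \<Union>\<^sub>k arch k P\<close>, where \<open>k\<close> is the length of the down-run at the cut and
  ranges over the allowed lengths; cutting before its last component gives \<open>P = \<epsilon> \<union> \<Union>\<^sub>k P arch k\<close>.
  Substituting the second form for the last \<open>P\<close> in \<open>(U P)\<^sup>A\<close> turns \<open>(U P)\<^sup>A D\<^sup>A P\<close> into the union of
  \<open>arch A P\<close> and all \<open>arch (A + j) P\<close> with \<open>j\<close> allowed. Both sides of the grammatical equation are
  then unions of the same pairwise disjoint languages \<open>arch k P\<close>, since \<open>k\<close> is allowed or equal
  to \<open>B\<close> iff \<open>k \<le> A\<close> or \<open>k - A\<close> is allowed. All concatenations involved are unambiguous,
  so counting words by their number of up-steps gives the equation for the enumerator.
\<close>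

subsection \<open>Languages\<close>

lemma conc_iff: "w \<in> L @@ M \<longleftrightarrow> (\<exists>x y. w = x @ y \<and> x \<in> L \<and> y \<in> M)"
  by (auto simp: conc_def)

lemma concI: "x \<in> L \<Longrightarrow> y \<in> M \<Longrightarrow> x @ y \<in> L @@ M"
  by (auto simp: conc_def)

lemma conc_mono: "L \<subseteq> L' \<Longrightarrow> M \<subseteq> M' \<Longrightarrow> L @@ M \<subseteq> L' @@ M'"
  by (auto simp: conc_def)

lemma conc_assoc: "(L @@ M) @@ N = L @@ M @@ N"
proof (rule set_eqI)
  fix w show "w \<in> (L @@ M) @@ N \<longleftrightarrow> w \<in> L @@ M @@ N"
    unfolding conc_iff by (metis append.assoc)
qed

lemma conc_Nil_left [simp]: "{[]} @@ L = L"
  by (auto simp: conc_def)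

lemma conc_Nil_right [simp]: "L @@ {[]} = L"
  by (auto simp: conc_def)

lemma conc_Un_left: "(L \<union> M) @@ N = L @@ N \<union> M @@ N"
  and conc_Un_right: "N @@ (L \<union> M) = N @@ L \<union> N @@ M"
  by (auto simp: conc_def)

lemma conc_UN_left: "(\<Union>i\<in>I. F i) @@ N = (\<Union>i\<in>I. F i @@ N)"
  and conc_UN_right: "N @@ (\<Union>i\<in>I. F i) = (\<Union>i\<in>I. N @@ F i)"
  by (auto simp: conc_def)

lemma lang_pow_add: "L ^^^ (m + n) = L ^^^ m @@ L ^^^ n"
  by (induction m) (simp_all add: conc_assoc)

lemma lang_pow_Suc_right: "L ^^^ Suc n = L ^^^ n @@ L"
  using lang_pow_add[of L n 1] by simp

lemma DD_pow: "DD ^^^ k = {replicate k D}"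
  by (induction k) (auto simp: conc_def)

subsection \<open>Heights\<close>

lemma height_simps [simp]:
  "height [] = 0" "height (s # w) = step_val s + height w"
  "height (u @ v) = height u + height v" "height (replicate k D) = - int k"
  by (auto simp: height_def sum_list_replicate)

text \<open>The bound is re-based at each letter, so that words can be split by simplification. The
  empty prefix counts too, which is why \<open>c \<le> 0\<close> is demanded at every
  position.\<close>

fun above :: "int \<Rightarrow> word \<Rightarrow> bool" where
  "above c [] \<longleftrightarrow> c \<le> 0"
| "above c (s # w) \<longleftrightarrow> c \<le> 0 \<and> above (c - step_val s) w"

lemma above_iff: "above c w \<longleftrightarrow> (\<forall>i \<le> length w. c \<le> height (take i w))"
proof (induction w arbitrary: c)
  case (Cons s w)
  have "(\<forall>i \<le> length (s # w). c \<le> height (take i (s # w))) \<longleftrightarrow>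
      c \<le> 0 \<and> (\<forall>i \<le> length w. c - step_val s \<le> height (take i w))" (is "?L \<longleftrightarrow> ?R")
  proof
    assume L: ?L
    have "c - step_val s \<le> height (take i w)" if "i \<le> length w" for i
      using L[rule_format, of "Suc i"] that by simp
    moreover have "c \<le> 0" using L[rule_format, of 0] by simp
    ultimately show ?R by simp
  next
    assume R: ?R
    show ?L
    proof (intro allI impI)
      fix i assume "i \<le> length (s # w)"
      then show "c \<le> height (take i (s # w))"
        using R by (cases i) (auto simp: algebra_simps)
    qed
  qed
  then show ?case using Cons.IH by simp
qed simp

lemma dyck_iff: "dyck w \<longleftrightarrow> above 0 w \<and> height w = 0"
  by (simp add: dyck_def above_iff)

lemma above_append: "above c (u @ v) \<longleftrightarrow> above c u \<and> above (c - height u) v"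
proof (induction u arbitrary: c)
  case Nil
  show ?case by (cases v) auto
qed (auto simp: algebra_simps)

lemma above_mono: "above c w \<Longrightarrow> c' \<le> c \<Longrightarrow> above c' w"
  by (auto simp: above_iff)

lemma above_nonpos: "above c w \<Longrightarrow> c \<le> 0"
  by (cases w) auto

lemma above_height: "above c w \<Longrightarrow> c \<le> height w"
  by (induction w arbitrary: c) force+

lemma above_replicate_D: "above c (replicate k D) \<longleftrightarrow> c \<le> - int k"
proof (induction k arbitrary: c)
  case (Suc k)
  have "above c (replicate (Suc k) D) \<longleftrightarrow> c \<le> 0 \<and> c + 1 \<le> - int k"
    by (simp only: replicate_Suc above.simps step_val.simps Suc.IH diff_minus_eq_add)
  then show ?case by linarith
qed simp

text \<open>The displayed \<open>U\<close> is the last step leaving level \<open>n\<close>; from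
  then on the path stays above that level, so \<open>b\<close> is a Dyck path.\<close>

lemma last_passage:
  assumes "above 0 v" "height v = int (Suc n)"
  obtains a b where "v = a @ U # b" "above 0 a" "height a = int n" "dyck b"
proof -
  have "\<exists>a b. v = a @ U # b \<and> above 0 a \<and> height a = int n \<and> dyck b"
    using assms
  proof (induction "length v" arbitrary: v n rule: less_induct)
    case less
    from less.prems obtain v' s where v: "v = v' @ [s]" by (cases v rule: rev_cases) auto
    show ?case
    proof (cases s)
      case U
      with v less.prems have "above 0 v'" "height v' = int n" by (auto simp: above_append)
      moreover have "v = v' @ U # []" "dyck []" using v U by (simp_all add: dyck_iff)
      ultimately show ?thesis by blast
    next
      case D
      with v less.prems have "above 0 v'" "height v' = int (Suc (Suc n))"
        by (auto simp: above_append)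
      moreover have "length v' < length v" using v by simp
      ultimately obtain a b where
        ab: "v' = a @ U # b" "above 0 a" "height a = int (Suc n)" "dyck b"
        using less.hyps[of v' "Suc n"] by auto
      \<comment> \<open>Since \<open>v'\<close> ends at level \<open>n + 2\<close>, two last
        passages are peeled off. The final \<open>D\<close> closes the upper one, and the lower one
        is the passage sought.\<close>
      moreover have "length a < length v" using v ab(1) by simp
      ultimately obtain a' b' where
        ab': "a = a' @ U # b'" "above 0 a'" "height a' = int n" "dyck b'"
        using less.hyps[of a n] by auto
      have "dyck (b' @ U # b @ [D])"
        using ab(4) ab'(4) above_mono[of 0 b "- 1"] by (simp add: dyck_iff above_append)
      moreover have "v = a' @ U # (b' @ U # b @ [D])" using v D ab ab' by simp
      ultimately show ?thesis using ab'(2,3) by blast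
    qed
  qed
  then show thesis using that by fast
qed

lemma trailing_down_run: "\<exists>j. w = replicate j D \<or> (\<exists>v. w = v @ U # replicate j D)"
proof (induction w rule: rev_induct)
  case (snoc s w)
  then obtain j where j: "w = replicate j D \<or> (\<exists>v. w = v @ U # replicate j D)" by blast
  show ?case
  proof (cases s)
    case U
    then show ?thesis by (intro exI[of _ 0]) auto
  next
    case D
    with j show ?thesis
      by (intro exI[of _ "Suc j"]) (auto simp: replicate_append_same)
  qed
qed auto

text \<open>Read from the right, the word has exactly \<open>k\<close> letters \<open>D\<close>
  before its first \<open>U\<close>. This recovers the index of an arch from the arch.\<close>

lemma trailing_down_run_unique:
  assumes "x @ U # replicate k D = y @ U # replicate j D"
  shows "k = j"
proof -
  have "takeWhile (\<lambda>s. s = D) (replicate i D @ U # z) = replicate i D" for z i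
    by (induction i) auto
  then have "takeWhile (\<lambda>s. s = D) (rev (z @ U # replicate i D)) = replicate i D" for z i
    by simp
  from this[of x k] this[of y j] assms show ?thesis by (metis length_replicate)
qed

text \<open>The \<open>D\<close> after \<open>y\<close> is the first step below the starting level
  of \<open>y\<close>. A strictly longer Dyck path extending \<open>y\<close> would contain that
  step.\<close>

lemma first_return_unique:
  assumes "dyck y" "dyck y'" "U # y @ D # r = U # y' @ D # r'"
  shows "y = y'"
proof -
  have no: "s = []" if "dyck y" "dyck (y @ s)" "s @ D # q = D # q'" for y s q q'
    using that by (cases s) (auto simp: dyck_iff above_append dest: above_nonpos)
  from assms(3) have "y @ D # r = y' @ D # r'" by simp
  then consider s where "y = y' @ s" "s @ D # r = D # r'"
    | s where "y' = y @ s" "s @ D # r' = D # r"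
    unfolding append_eq_append_conv2 by metis
  then show ?thesis
    by cases (use no assms(1,2) in fastforce)+
qed

subsection \<open>Down-runs\<close>

text \<open>A \<open>U\<close> ends every block of \<open>D\<close>s and makes its neighbours
  maximal, so each run lies wholly on one side of it.\<close>

lemma has_down_run_append_U:
  "has_down_run (u @ U # v) l \<longleftrightarrow> has_down_run u l \<or> has_down_run v l"
proof
  assume "has_down_run (u @ U # v) l"
  then obtain x y where l: "1 \<le> l" and eq: "u @ U # v = x @ replicate l D @ y"
    and x: "x = [] \<or> last x \<noteq> D" and y: "y = [] \<or> hd y \<noteq> D"
    by (auto simp: has_down_run_def)
  from eq consider z where "x = u @ z" "U # v = z @ replicate l D @ y"
    | z where "u = x @ z" "z @ U # v = replicate l D @ y"
    unfolding append_eq_append_conv2 by metis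
  then show "has_down_run u l \<or> has_down_run v l"
  proof cases
    case 1
    from 1(2) l obtain z' where z: "z = U # z'" "v = z' @ replicate l D @ y"
      by (cases z; cases l) auto
    with x 1 have "z' = [] \<or> last z' \<noteq> D" by auto
    with z l y show ?thesis by (auto simp: has_down_run_def)
  next
    case 2
    from 2(2) consider r where "z = replicate l D @ r" "y = r @ U # v"
      | r where "replicate l D = z @ r" "U # v = r @ y"
      unfolding append_eq_append_conv2 by metis
    then show ?thesis
    proof cases
      case (1 r)
      then have "r = [] \<or> hd r \<noteq> D" using y by (cases r) auto
      with 1 2 l x show ?thesis by (auto simp: has_down_run_def)
    next
      case (2 r)
      \<comment> \<open>A part \<open>r\<close> of the run reaching past \<open>u\<close> would have
        to begin with the separating \<open>U\<close>.\<close>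
      have "set r \<subseteq> {D}" using arg_cong[OF 2(1), of set] by (auto split: if_splits)
      with 2 have "r = []" by (cases r) auto
      with 2 \<open>u = x @ z\<close> have "u = x @ replicate l D @ []" by simp
      with l x have "has_down_run u l" unfolding has_down_run_def by blast
      then show ?thesis ..
    qed
  qed
next
  assume "has_down_run u l \<or> has_down_run v l"
  then show "has_down_run (u @ U # v) l"
  proof
    assume "has_down_run u l"
    then obtain x y where "1 \<le> l" "u = x @ replicate l D @ y"
      "x = [] \<or> last x \<noteq> D" "y = [] \<or> hd y \<noteq> D"
      by (auto simp: has_down_run_def)
    then show ?thesis
      unfolding has_down_run_def
      by (intro conjI exI[of _ x] exI[of _ "y @ U # v"]) (auto simp: hd_append)
  next
    assume "has_down_run v l"
    then obtain x y where "1 \<le> l" "v = x @ replicate l D @ y"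
      "x = [] \<or> last x \<noteq> D" "y = [] \<or> hd y \<noteq> D"
      by (auto simp: has_down_run_def)
    then show ?thesis
      unfolding has_down_run_def
      by (intro conjI exI[of _ "u @ U # x"] exI[of _ y]) auto
  qed
qed

lemma has_down_run_replicate_D: "has_down_run (replicate k D) l \<longleftrightarrow> l = k \<and> 1 \<le> k"
proof
  assume "has_down_run (replicate k D) l"
  then obtain x y where l: "1 \<le> l" and eq: "replicate k D = x @ replicate l D @ y"
    and x: "x = [] \<or> last x \<noteq> D" and y: "y = [] \<or> hd y \<noteq> D"
    by (auto simp: has_down_run_def)
  have "set x \<subseteq> {D}" "set y \<subseteq> {D}" using arg_cong[OF eq, of set] by (auto split: if_splits)
  have "x = []"
  proof (rule ccontr)
    assume "x \<noteq> []"
    with \<open>set x \<subseteq> {D}\<close> last_in_set[of x] x show False by blast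
  qed
  moreover have "y = []"
  proof (rule ccontr)
    assume "y \<noteq> []"
    with \<open>set y \<subseteq> {D}\<close> hd_in_set[of y] y show False by blast
  qed
  ultimately show "l = k \<and> 1 \<le> k" using eq l by (metis append_Nil append_Nil2 length_replicate)
next
  assume "l = k \<and> 1 \<le> k"
  then show "has_down_run (replicate k D) l"
    unfolding has_down_run_def by (intro conjI exI[of _ "[]"]) auto
qed

definition avoids :: "nat set \<Rightarrow> word \<Rightarrow> bool" where
  "avoids S w \<longleftrightarrow> (\<forall>l. has_down_run w l \<longrightarrow> l \<notin> S)"

lemma dyck_avoiding_iff: "w \<in> dyck_avoiding S \<longleftrightarrow> dyck w \<and> avoids S w"
  by (simp add: dyck_avoiding_def avoids_def)

lemma avoids_replicate_D: "avoids S (replicate k D) \<longleftrightarrow> k = 0 \<or> k \<notin> S"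
  by (auto simp: avoids_def has_down_run_replicate_D)

lemma avoids_Nil [simp]: "avoids S []"
  using avoids_replicate_D[of S 0] by simp

lemma avoids_append_U: "avoids S (u @ U # v) \<longleftrightarrow> avoids S u \<and> avoids S v"
  by (auto simp: avoids_def has_down_run_append_U)

lemma avoids_U [simp]: "avoids S (U # v) \<longleftrightarrow> avoids S v"
  using avoids_append_U[of S "[]" v] by simp

text \<open>A nonnegative \<open>v\<close> is empty or starts with \<open>U\<close>, so no run
  crosses the boundary.\<close>

lemma avoids_append:
  assumes "above 0 v"
  shows "avoids S (u @ v) \<longleftrightarrow> avoids S u \<and> avoids S v"
proof (cases v)
  case (Cons s v')
  with assms have "s = U" by (cases s) (auto dest: above_nonpos)
  with Cons show ?thesis by (simp add: avoids_append_U)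
qed simp

lemma Nil_in_dyck_avoiding [simp]: "[] \<in> dyck_avoiding S"
  by (simp add: dyck_avoiding_iff dyck_iff)

subsection \<open>Decompositions of Dyck paths\<close>

text \<open>The second part says that such a word never returns to its starting level after its
  first step; primality and unambiguity below rest on it.\<close>

lemma up_pow_cases:
  assumes "x \<in> (UU @@ dyck_avoiding S) ^^^ n"
  shows "above 0 x \<and> height x = int n \<and> avoids S x"
    and "x = [] \<or> (\<exists>y. x = U # y \<and> above 0 y)"
proof -
  have "above 0 x \<and> height x = int n \<and> avoids S x \<and> (x = [] \<or> (\<exists>y. x = U # y \<and> above 0 y))"
    using assms
  proof (induction n arbitrary: x)
    case (Suc n)
    then obtain p y where x: "x = U # p @ y" and p: "p \<in> dyck_avoiding S"
      and y: "y \<in> (UU @@ dyck_avoiding S) ^^^ n"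
      by (auto simp: conc_iff)
    with Suc.IH[OF y] show ?case
      using above_mono[of 0 p "- 1"] above_mono[of 0 y "- 1"]
      by (simp add: dyck_avoiding_iff dyck_iff above_append avoids_append)
  qed simp
  then show "above 0 x \<and> height x = int n \<and> avoids S x"
    and "x = [] \<or> (\<exists>y. x = U # y \<and> above 0 y)" by blast+
qed

text \<open>Cutting at the last passage out of each level below \<open>n\<close>, from the top down,
  leaves avoiding Dyck paths between the cuts.\<close>

lemma nonneg_path_decomp:
  assumes "above 0 v" "avoids S v" "height v = int n"
  shows "v \<in> dyck_avoiding S @@ (UU @@ dyck_avoiding S) ^^^ n"
  using assms
proof (induction n arbitrary: v)
  case 0
  then show ?case by (simp add: dyck_avoiding_iff dyck_iff)
next
  case (Suc n)
  from last_passage[OF Suc.prems(1,3)] obtain a b where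
    ab: "v = a @ U # b" "above 0 a" "height a = int n" "dyck b" .
  with Suc.prems have av: "avoids S a" "avoids S b" by (simp_all add: avoids_append_U)
  have "a \<in> dyck_avoiding S @@ (UU @@ dyck_avoiding S) ^^^ n"
    using Suc.IH ab av by blast
  moreover have "U # b \<in> UU @@ dyck_avoiding S"
    using ab av by (auto simp: conc_iff dyck_avoiding_iff)
  ultimately show ?case
    unfolding ab lang_pow_Suc_right conc_assoc[symmetric, of "dyck_avoiding S"] by (rule concI)
qed

text \<open>Meant for \<open>k \<ge> 1\<close>, as \<open>k - 1\<close> is truncated. Only the inner
  paths must avoid \<open>S\<close>: the closing length \<open>k\<close> may itself be forbidden, as
  happens for \<open>k = B\<close>.\<close>

definition arch :: "nat set \<Rightarrow> nat \<Rightarrow> word set" where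
  "arch S k = (UU @@ dyck_avoiding S) ^^^ (k - 1) @@ UU @@ DD ^^^ k"

lemma arch_conc:
  "arch S k @@ L = (UU @@ dyck_avoiding S) ^^^ (k - 1) @@ UU @@ DD ^^^ k @@ L"
  by (simp add: arch_def conc_assoc)

lemma in_arch_iff:
  "t \<in> arch S k \<longleftrightarrow>
    (\<exists>x \<in> (UU @@ dyck_avoiding S) ^^^ (k - 1). t = x @ U # replicate k D)"
  by (auto simp: arch_def conc_iff DD_pow)

lemma arch_dyck:
  assumes "t \<in> arch S k" "1 \<le> k"
  shows "dyck t" "avoids S t \<longleftrightarrow> k \<notin> S"
proof -
  from assms(1) obtain x where x: "x \<in> (UU @@ dyck_avoiding S) ^^^ (k - 1)"
    and t: "t = x @ U # replicate k D" by (auto simp: in_arch_iff)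
  note * = up_pow_cases(1)[OF x]
  show "dyck t"
    using * assms(2) by (auto simp: t dyck_iff above_append above_replicate_D)
  show "avoids S t \<longleftrightarrow> k \<notin> S"
    using * assms(2) by (auto simp: t avoids_append_U avoids_replicate_D)
qed

lemma dyck_append: "dyck u \<Longrightarrow> dyck v \<Longrightarrow> dyck (u @ v)"
  by (auto simp: dyck_iff above_append)

lemma arch_subset:
  assumes "1 \<le> k" "k \<notin> S"
  shows "arch S k \<subseteq> dyck_avoiding S"
  using arch_dyck[OF _ assms(1), where S = S] assms(2) by (auto simp: dyck_avoiding_iff)

lemma dyck_avoiding_append:
  "u \<in> dyck_avoiding S \<Longrightarrow> v \<in> dyck_avoiding S \<Longrightarrow> u @ v \<in> dyck_avoiding S"
  using avoids_append[of v S u] by (simp add: dyck_avoiding_iff dyck_append) (simp add: dyck_iff)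

text \<open>Removing the final \<open>U\<close> and the down-run of length \<open>j\<close> after it
  leaves a nonnegative path to height \<open>j - 1\<close>, which decomposes by last
  passages.\<close>

lemma last_arch:
  assumes "w \<in> dyck_avoiding S" "w \<noteq> []"
  obtains j where "1 \<le> j" "j \<notin> S" "w \<in> dyck_avoiding S @@ arch S j"
proof -
  have w: "above 0 w" "height w = 0" "avoids S w"
    using assms(1) by (simp_all add: dyck_avoiding_iff dyck_iff)
  from trailing_down_run[of w] obtain j v where "w = replicate j D \<or> w = v @ U # replicate j D"
    by blast
  \<comment> \<open>A word consisting only of \<open>D\<close>s has height 0 only if it is
    empty.\<close>
  with w assms(2) have wv: "w = v @ U # replicate j D" by auto
  with w have v: "above 0 v" "height v = int j - 1" "avoids S v" "avoids S (replicate j D)"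
    by (auto simp: above_append avoids_append_U)
  with above_height[OF v(1)] have j: "1 \<le> j" "j \<notin> S" and h: "height v = int (j - 1)"
    by (auto simp: avoids_replicate_D)
  have "w \<in> (dyck_avoiding S @@ (UU @@ dyck_avoiding S) ^^^ (j - 1)) @@ UU @@ DD ^^^ j"
    unfolding wv by (intro concI nonneg_path_decomp v h) (simp add: conc_iff DD_pow)
  then have "w \<in> dyck_avoiding S @@ arch S j" by (simp add: arch_def conc_assoc)
  with j show thesis by (rule that)
qed

lemma dyck_avoiding_conc:
  "L \<subseteq> dyck_avoiding S \<Longrightarrow> M \<subseteq> dyck_avoiding S \<Longrightarrow> L @@ M \<subseteq> dyck_avoiding S"
  unfolding conc_iff subset_iff using dyck_avoiding_append by metis

lemma dyck_avoiding_last: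
  "dyck_avoiding S = {[]} \<union> (\<Union>j\<in>{1..} - S. dyck_avoiding S @@ arch S j)" (is "_ = ?R")
proof
  show "dyck_avoiding S \<subseteq> ?R"
  proof
    fix w assume "w \<in> dyck_avoiding S"
    show "w \<in> ?R"
    proof (cases "w = []")
      case False
      with \<open>w \<in> dyck_avoiding S\<close> obtain j where
        "1 \<le> j" "j \<notin> S" "w \<in> dyck_avoiding S @@ arch S j" by (rule last_arch)
      then show ?thesis by blast
    qed simp
  qed
  show "?R \<subseteq> dyck_avoiding S"
    by (intro Un_least UN_least dyck_avoiding_conc arch_subset) auto
qed

text \<open>Strip the last arch. If nothing remains, it is also the first one; otherwise the shorter
  remainder has a first arch, and the stripped arch joins the rest.\<close>

lemma dyck_avoiding_first:
  "dyck_avoiding S = {[]} \<union> (\<Union>j\<in>{1..} - S. arch S j @@ dyck_avoiding S)" (is "_ = ?R")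
proof
  show "?R \<subseteq> dyck_avoiding S"
    by (intro Un_least UN_least dyck_avoiding_conc arch_subset) auto
  show "dyck_avoiding S \<subseteq> ?R"
  proof
    fix w assume "w \<in> dyck_avoiding S"
    then show "w \<in> ?R"
    proof (induction "length w" arbitrary: w rule: less_induct)
      case less
      show ?case
      proof (cases "w = []")
        case False
        with less.prems obtain j where j: "1 \<le> j" "j \<notin> S"
          "w \<in> dyck_avoiding S @@ arch S j" by (rule last_arch)
        then obtain q t where qt: "w = q @ t" "q \<in> dyck_avoiding S" "t \<in> arch S j"
          by (auto simp: conc_iff)
        show ?thesis
        proof (cases "q = []")
          case True
          then have "w \<in> arch S j @@ dyck_avoiding S"
            using qt concI[of t "arch S j" "[]" "dyck_avoiding S"] by simp
          with j show ?thesis by blast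
        next
          case False
          have "length q < length w" using qt by (auto simp: in_arch_iff)
          from less.hyps[OF this qt(2)] False obtain i where
            i: "i \<in> {1..} - S" "q \<in> arch S i @@ dyck_avoiding S" by blast
          then obtain s p where sp: "q = s @ p" "s \<in> arch S i" "p \<in> dyck_avoiding S"
            unfolding conc_iff by blast
          have "t \<in> dyck_avoiding S" using qt(3) arch_subset[OF j(1,2)] by blast
          with sp have "s @ p @ t \<in> arch S i @@ dyck_avoiding S"
            by (intro concI dyck_avoiding_append)
          with i(1) qt(1) sp(1) show ?thesis by auto
        qed
      qed simp
    qed
  qed
qed

text \<open>If the last inner path is empty, the word starts with an arch of index \<open>A\<close>.
  If it ends with an arch of index \<open>j\<close>, the closing run of length \<open>j\<close>
  merges with the following \<open>A\<close> down-steps into one run of length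
  \<open>A + j\<close>.\<close>

lemma up_pow_down_pow_eq:
  assumes "1 \<le> A"
  shows "(UU @@ dyck_avoiding S) ^^^ A @@ DD ^^^ A @@ L =
    arch S A @@ L \<union> (\<Union>j\<in>{1..} - S. arch S (A + j) @@ L)"
proof -
  let ?P = "dyck_avoiding S" and ?W = "(UU @@ dyck_avoiding S) ^^^ (A - 1)"
  have "(UU @@ ?P) ^^^ A = ?W @@ UU @@ ?P"
    using assms lang_pow_Suc_right[of "UU @@ ?P" "A - 1"] by simp
  also have "\<dots> = ?W @@ UU @@ ({[]} \<union> (\<Union>j\<in>{1..} - S. ?P @@ arch S j))"
    using dyck_avoiding_last[of S] by simp
  finally have *: "(UU @@ ?P) ^^^ A @@ DD ^^^ A @@ L =
      ?W @@ UU @@ DD ^^^ A @@ L \<union>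
      (\<Union>j\<in>{1..} - S. ?W @@ UU @@ ?P @@ arch S j @@ DD ^^^ A @@ L)"
    by (simp only: conc_Un_right conc_UN_right conc_Un_left conc_UN_left conc_assoc
        conc_Nil_left)
  have "?W @@ UU @@ ?P @@ arch S j @@ DD ^^^ A @@ L = arch S (A + j) @@ L"
    if "j \<in> {1..} - S" for j
  proof -
    \<comment> \<open>The factors counted are the first \<open>A - 1\<close>, one for the
      \<open>U\<close> with the path before the last arch, and \<open>j - 1\<close> inside that
      arch.\<close>
    have "A + j - 1 = (A - 1) + Suc (j - 1)" using assms that by simp
    then have "(UU @@ ?P) ^^^ (A + j - 1) = ?W @@ UU @@ ?P @@ (UU @@ ?P) ^^^ (j - 1)"
      by (simp only: lang_pow_add lang_pow.simps conc_assoc)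
    moreover have "DD ^^^ (A + j) = DD ^^^ j @@ DD ^^^ A"
      by (simp only: lang_pow_add[symmetric] add.commute)
    ultimately show ?thesis by (simp only: arch_def conc_assoc)
  qed
  with * show ?thesis by (simp add: arch_conc)
qed

subsection \<open>Unambiguity\<close>

definition unambiguous :: "word set \<Rightarrow> word set \<Rightarrow> bool" where
  "unambiguous L M \<longleftrightarrow> inj_on (\<lambda>(x, y). x @ y) (L \<times> M)"

text \<open>Equal left factors suffice, since the right factors then agree by cancellation.\<close>

lemma unambiguousI:
  assumes "\<And>x y x' y'. x \<in> L \<Longrightarrow> y \<in> M \<Longrightarrow> x' \<in> L \<Longrightarrow> y' \<in> M \<Longrightarrow> x @ y = x' @ y' \<Longrightarrow> x = x'"
  shows "unambiguous L M"
  using assms unfolding unambiguous_def inj_on_def by fastforce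

lemma unambiguous_singleton: "unambiguous {x} M" "unambiguous L {x}"
  by (auto intro: unambiguousI)

section \<open>Prime Dyck paths as a prefix code\<close>

definition prime_dyck :: "word set" where
  "prime_dyck = {U # y @ [D] | y. dyck y}"

lemma prime_dyck_unique:
  assumes "x \<in> prime_dyck" "x' \<in> prime_dyck" "x @ y = x' @ y'"
  shows "x = x'"
proof -
  from assms(1,2) obtain p p' where p: "x = U # p @ [D]" "x' = U # p' @ [D]" "dyck p" "dyck p'"
    unfolding prime_dyck_def by blast
  with assms(3) have "p = p'" by (intro first_return_unique[of p p' y y']) simp_all
  with p show ?thesis by simp
qed

lemma unambiguous_prime_dyck:
  assumes "L \<subseteq> prime_dyck"
  shows "unambiguous L M"
proof (rule unambiguousI)
  fix x y x' y' assume "x \<in> L" "x' \<in> L" "x @ y = x' @ y'"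
  with assms show "x = x'" by (intro prime_dyck_unique[of x x' y y']) auto
qed

text \<open>After the first \<open>U\<close> the path stays at height at least 1 until the last of
  the \<open>k\<close> closing down-steps.\<close>

lemma up_pow_down_pow_prime:
  assumes "1 \<le> k"
  shows "(UU @@ dyck_avoiding S) ^^^ k @@ DD ^^^ k \<subseteq> prime_dyck"
proof
  fix w assume "w \<in> (UU @@ dyck_avoiding S) ^^^ k @@ DD ^^^ k"
  then obtain x where x: "x \<in> (UU @@ dyck_avoiding S) ^^^ k" and w: "w = x @ replicate k D"
    unfolding conc_iff[of w] DD_pow by blast
  have h: "height x = int k" using up_pow_cases(1)[OF x] by blast
  with assms have "x \<noteq> []" by auto
  then obtain y where y: "x = U # y" "above 0 y" using up_pow_cases(2)[OF x] by metis
  have hy: "height y = int (k - 1)" using h y(1) assms by (simp add: of_nat_diff)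
  have "dyck (y @ replicate (k - 1) D)"
    unfolding dyck_iff above_append above_replicate_D height_simps hy using y(2) by simp
  moreover have "replicate k D = replicate (k - 1) D @ [D]"
    using assms by (cases k) (simp_all add: replicate_append_same)
  then have "w = U # (y @ replicate (k - 1) D) @ [D]"
    unfolding w y(1) by (simp only: append_Cons append_assoc)
  ultimately show "w \<in> prime_dyck" unfolding prime_dyck_def by (intro CollectI exI conjI)
qed

text \<open>An arch is the case where the last inner path is empty.\<close>

lemma arch_subset_up_pow:
  assumes "1 \<le> k"
  shows "arch S k \<subseteq> (UU @@ dyck_avoiding S) ^^^ k @@ DD ^^^ k"
proof -
  have "UU \<subseteq> UU @@ dyck_avoiding S"
    using concI[of "[U]" UU "[]" "dyck_avoiding S"] by simp
  then have "arch S k \<subseteq> (UU @@ dyck_avoiding S) ^^^ (k - 1) @@ (UU @@ dyck_avoiding S) @@ DD ^^^ k"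
    unfolding arch_def by (intro conc_mono subset_refl)
  also have "\<dots> = (UU @@ dyck_avoiding S) ^^^ Suc (k - 1) @@ DD ^^^ k"
    by (simp only: lang_pow_Suc_right conc_assoc)
  finally show ?thesis using assms by simp
qed

lemma arch_prime: "1 \<le> k \<Longrightarrow> arch S k \<subseteq> prime_dyck"
  using arch_subset_up_pow up_pow_down_pow_prime by blast

text \<open>The initial prime factor of a word is determined, and its trailing down-run determines
  the index; what follows is arbitrary.\<close>

lemma arch_conc_disjoint:
  assumes "1 \<le> k" "1 \<le> j" "k \<noteq> j"
  shows "(arch S k @@ L) \<inter> (arch S j @@ M) = {}"
proof (rule ccontr)
  assume "\<not> ?thesis"
  then obtain t q t' q' where t: "t \<in> arch S k" "t' \<in> arch S j" and eq: "t @ q = t' @ q'"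
    by (auto simp: conc_iff)
  have "t = t'" using prime_dyck_unique eq t arch_prime assms(1,2) by blast
  with t assms(3) show False by (auto simp: in_arch_iff dest: trailing_down_run_unique)
qed

lemma Nil_notin_arch_conc: "[] \<notin> arch S k @@ L"
  by (auto simp: conc_iff in_arch_iff)

text \<open>If one inner Dyck path properly extended the other, the extra piece would have height 0.
  But it is a nonempty prefix of a word in the power, so it starts with \<open>U\<close> and ends at
  height at least 1.\<close>

lemma unambiguous_up: "unambiguous (UU @@ dyck_avoiding S) ((UU @@ dyck_avoiding S) ^^^ n)"
proof (rule unambiguousI)
  have no: "r = []"
    if "dyck p" "dyck (p @ r)" "r @ m' \<in> (UU @@ dyck_avoiding S) ^^^ n" for p r m'
    using up_pow_cases(2)[OF that(3)] that(1,2)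
    by (cases r) (auto simp: dyck_iff above_append dest: above_height above_nonpos)
  fix x y x' y'
  assume "x \<in> UU @@ dyck_avoiding S" "x' \<in> UU @@ dyck_avoiding S"
    and y: "y \<in> (UU @@ dyck_avoiding S) ^^^ n" "y' \<in> (UU @@ dyck_avoiding S) ^^^ n"
    and eq: "x @ y = x' @ y'"
  then obtain p p' where p: "x = U # p" "x' = U # p'" "dyck p" "dyck p'"
    by (auto simp: conc_iff dyck_avoiding_iff)
  with eq have "p @ y = p' @ y'" by simp
  then consider r where "p = p' @ r" "r @ y = y'" | r where "p' = p @ r" "r @ y' = y"
    unfolding append_eq_append_conv2 by metis
  then have "p = p'"
    by cases (use no p(3,4) y in fastforce)+
  with p show "x = x'" by simp
qed

subsection \<open>Enumeration by up-steps\<close>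

definition up_count :: "word set \<Rightarrow> nat \<Rightarrow> word set" where
  "up_count L n = {w \<in> L. count_list w U = n}"

definition up_finite :: "word set \<Rightarrow> bool" where
  "up_finite L \<longleftrightarrow> (\<forall>n. finite (up_count L n))"

text \<open>
  Unlike the length, the number of up-steps gives the one-letter languages the weights \<open>z\<close> and \<open>1\<close>,
  and it is half the length on Dyck paths. A fixed number of up-steps does not bound the length,
  so \<open>up_finite\<close> is needed to exclude the junk value \<open>card = 0\<close> of infinite sets.
\<close>
definition up_enum :: "word set \<Rightarrow> int fps" where
  "up_enum L = Abs_fps (\<lambda>n. int (card (up_count L n)))"

lemma up_count_conc:
  "up_count (L @@ M) n = (\<lambda>(x, y). x @ y) ` (\<Union>i\<in>{0..n}. up_count L i \<times> up_count M (n - i))"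
proof (intro equalityI subsetI)
  fix w assume "w \<in> up_count (L @@ M) n"
  then obtain x y where w: "w = x @ y" "x \<in> L" "y \<in> M" "count_list x U + count_list y U = n"
    by (auto simp: up_count_def conc_iff)
  then have "(x, y) \<in> up_count L (count_list x U) \<times> up_count M (n - count_list x U)"
    "count_list x U \<in> {0..n}"
    by (auto simp: up_count_def)
  with w(1) show "w \<in> (\<lambda>(x, y). x @ y) ` (\<Union>i\<in>{0..n}. up_count L i \<times> up_count M (n - i))"
    by blast
qed (auto simp: up_count_def conc_iff)

lemma up_finite_conc: "up_finite L \<Longrightarrow> up_finite M \<Longrightarrow> up_finite (L @@ M)"
  by (simp add: up_finite_def up_count_conc)

lemma up_enum_conc:
  assumes "up_finite L" "up_finite M" "unambiguous L M"
  shows "up_enum (L @@ M) = up_enum L * up_enum M"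
proof (rule fps_ext)
  fix n
  let ?F = "\<lambda>i. up_count L i \<times> up_count M (n - i)"
  have "inj_on (\<lambda>(x, y). x @ y) (\<Union>i\<in>{0..n}. ?F i)"
    by (rule inj_on_subset[OF assms(3)[unfolded unambiguous_def]]) (auto simp: up_count_def)
  then have "card (up_count (L @@ M) n) = card (\<Union>i\<in>{0..n}. ?F i)"
    by (simp add: up_count_conc card_image)
  also have "\<dots> = (\<Sum>i\<in>{0..n}. card (?F i))"
    using assms(1,2)
    \<comment> \<open>Different \<open>i\<close> give disjoint sets because \<open>i\<close> is the
      number of up-steps in the first component.\<close>
    by (intro card_UN_disjoint) (auto simp: up_finite_def, auto simp: up_count_def)
  finally show "fps_nth (up_enum (L @@ M)) n = fps_nth (up_enum L * up_enum M) n"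
    by (simp add: up_enum_def fps_mult_nth card_cartesian_product)
qed

lemma up_enum_Un:
  assumes "up_finite L" "up_finite M" "L \<inter> M = {}"
  shows "up_finite (L \<union> M)" "up_enum (L \<union> M) = up_enum L + up_enum M"
proof -
  have eq: "up_count (L \<union> M) n = up_count L n \<union> up_count M n" for n
    by (auto simp: up_count_def)
  show "up_finite (L \<union> M)" using assms(1,2) by (simp add: up_finite_def eq)
  show "up_enum (L \<union> M) = up_enum L + up_enum M"
  proof (rule fps_ext)
    fix n
    have "up_count L n \<inter> up_count M n = {}" using assms(3) by (auto simp: up_count_def)
    then show "fps_nth (up_enum (L \<union> M)) n = fps_nth (up_enum L + up_enum M) n"
      using assms(1,2) by (simp add: up_enum_def eq up_finite_def card_Un_disjoint)
  qed
qed

lemma up_finite_empty: "up_finite {}" and up_enum_empty: "up_enum {} = 0"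
  by (auto simp: up_finite_def up_count_def up_enum_def fps_eq_iff)

lemma up_enum_UN:
  assumes "finite I" "\<And>i. i \<in> I \<Longrightarrow> up_finite (F i)"
    "\<And>i j. i \<in> I \<Longrightarrow> j \<in> I \<Longrightarrow> i \<noteq> j \<Longrightarrow> F i \<inter> F j = {}"
  shows "up_finite (\<Union>i\<in>I. F i) \<and> up_enum (\<Union>i\<in>I. F i) = (\<Sum>i\<in>I. up_enum (F i))"
  using assms
proof (induction I rule: finite_induct)
  case (insert i I)
  have "F i \<inter> F j = {}" if "j \<in> I" for j
    using insert.prems(2)[of i j] insert.hyps(2) that by auto
  then have disj: "F i \<inter> (\<Union>i\<in>I. F i) = {}" by blast
  have IH: "up_finite (\<Union>i\<in>I. F i) \<and> up_enum (\<Union>i\<in>I. F i) = (\<Sum>i\<in>I. up_enum (F i))"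
    using insert.prems by (intro insert.IH) auto
  with up_enum_Un[OF insert.prems(1)[of i] _ disj] insert.hyps show ?case by simp
qed (simp add: up_finite_empty up_enum_empty)

section \<open>Enumerators of the languages in the equation\<close>

lemma up_finite_singleton: "up_finite {w}"
  by (auto simp: up_finite_def up_count_def)

lemma up_enum_singleton: "up_enum {w} = fps_X ^ count_list w U"
proof (rule fps_ext)
  fix n
  have "up_count {w} n = (if n = count_list w U then {w} else {})"
    by (auto simp: up_count_def)
  then show "fps_nth (up_enum {w}) n = fps_nth (fps_X ^ count_list w U) n"
    by (simp add: up_enum_def)
qed

text \<open>At height 0 this gives length \<open>2 * n\<close> for \<open>n\<close> up-steps,
  linking the up-step count to the semilength.\<close>

lemma length_eq_up_count: "int (length w) = 2 * int (count_list w U) - height w"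
proof (induction w)
  case (Cons s w)
  then show ?case by (cases s) auto
qed simp

lemma up_count_dyck_avoiding:
  "up_count (dyck_avoiding S) n = {w \<in> dyck_avoiding S. length w = 2 * n}"
proof -
  have "count_list w U = n \<longleftrightarrow> length w = 2 * n" if "w \<in> dyck_avoiding S" for w
    using length_eq_up_count[of w] that by (auto simp: dyck_avoiding_iff dyck_iff)
  then show ?thesis by (auto simp: up_count_def)
qed

lemma up_enum_dyck_avoiding: "up_enum (dyck_avoiding S) = weight_enum (dyck_avoiding S)"
  by (simp add: up_enum_def weight_enum_def up_count_dyck_avoiding)

lemma UNIV_step: "UNIV = {U, D}"
  using step.exhaust by blast

lemma up_finite_dyck_avoiding: "up_finite (dyck_avoiding S)"
proof -
  have "finite {w :: word. set w \<subseteq> {U, D} \<and> length w = 2 * n}" for n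
    by (intro finite_lists_length_eq) simp
  then show ?thesis
    unfolding up_finite_def up_count_dyck_avoiding
    by (auto intro: finite_subset simp: UNIV_step[symmetric])
qed

lemma up_pow_enum:
  "up_finite ((UU @@ dyck_avoiding S) ^^^ n) \<and>
   up_enum ((UU @@ dyck_avoiding S) ^^^ n) = (fps_X * weight_enum (dyck_avoiding S)) ^ n"
proof (induction n)
  case 0
  show ?case by (simp add: up_finite_singleton up_enum_singleton)
next
  case (Suc n)
  have "up_finite (UU @@ dyck_avoiding S)"
    "up_enum (UU @@ dyck_avoiding S) = fps_X * weight_enum (dyck_avoiding S)"
    by (simp_all add: up_finite_conc up_enum_conc up_finite_singleton up_finite_dyck_avoiding
        unambiguous_singleton up_enum_singleton up_enum_dyck_avoiding)
  with Suc show ?case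
    by (simp add: up_finite_conc up_enum_conc unambiguous_up)
qed

lemma conc_singleton_enum:
  assumes "up_finite L"
  shows "up_finite (L @@ {w})" "up_enum (L @@ {w}) = up_enum L * fps_X ^ count_list w U"
  using assms
  by (simp_all add: up_finite_conc up_enum_conc up_finite_singleton unambiguous_singleton
      up_enum_singleton)

lemma count_list_replicate_D [simp]: "count_list (replicate k D) U = 0"
  by (induction k) auto

lemma conc_dyck_avoiding_enum:
  assumes "up_finite L" "L \<subseteq> prime_dyck"
  shows "up_finite (L @@ dyck_avoiding S)"
    "up_enum (L @@ dyck_avoiding S) = up_enum L * weight_enum (dyck_avoiding S)"
  using assms
  by (simp_all add: up_finite_conc up_enum_conc up_finite_dyck_avoiding unambiguous_prime_dyck
      up_enum_dyck_avoiding)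

lemma arch_conc_enum:
  assumes "1 \<le> k"
  shows "up_finite (arch S k @@ dyck_avoiding S)"
    "up_enum (arch S k @@ dyck_avoiding S) = fps_X ^ k * weight_enum (dyck_avoiding S) ^ k"
proof -
  let ?P = "weight_enum (dyck_avoiding S)"
  have "UU @@ DD ^^^ k = {U # replicate k D}" by (auto simp: conc_def DD_pow)
  then have "up_finite (arch S k)" "up_enum (arch S k) = (fps_X * ?P) ^ (k - 1) * fps_X"
    using conc_singleton_enum[of "(UU @@ dyck_avoiding S) ^^^ (k - 1)"] up_pow_enum[of S "k - 1"]
    by (simp_all add: arch_def)
  \<comment> \<open>An arch has \<open>k\<close> up-steps but only \<open>k - 1\<close> inner paths;
    the path after it supplies the missing factor.\<close>
  moreover have "(fps_X * ?P) ^ (k - 1) * fps_X * ?P = (fps_X * ?P) ^ k"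
    using assms by (cases k) (simp_all add: mult_ac)
  ultimately show "up_finite (arch S k @@ dyck_avoiding S)"
    "up_enum (arch S k @@ dyck_avoiding S) = fps_X ^ k * ?P ^ k"
    using conc_dyck_avoiding_enum[OF _ arch_prime[OF assms]]
    by (simp_all add: power_mult_distrib)
qed

lemma up_pow_down_pow_enum:
  assumes "1 \<le> k"
  shows "up_finite ((UU @@ dyck_avoiding S) ^^^ k @@ DD ^^^ k @@ dyck_avoiding S)"
    "up_enum ((UU @@ dyck_avoiding S) ^^^ k @@ DD ^^^ k @@ dyck_avoiding S) =
      fps_X ^ k * weight_enum (dyck_avoiding S) ^ (k + 1)"
proof -
  let ?P = "weight_enum (dyck_avoiding S)"
  let ?L = "(UU @@ dyck_avoiding S) ^^^ k @@ DD ^^^ k"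
  have "up_finite ?L" "up_enum ?L = (fps_X * ?P) ^ k"
    using conc_singleton_enum[of "(UU @@ dyck_avoiding S) ^^^ k"] up_pow_enum[of S k]
    by (simp_all add: DD_pow)
  with conc_dyck_avoiding_enum[OF _ up_pow_down_pow_prime[OF assms]]
  have "up_finite (?L @@ dyck_avoiding S)"
    "up_enum (?L @@ dyck_avoiding S) = (fps_X * ?P) ^ k * ?P" by simp_all
  then show "up_finite ((UU @@ dyck_avoiding S) ^^^ k @@ DD ^^^ k @@ dyck_avoiding S)"
    "up_enum ((UU @@ dyck_avoiding S) ^^^ k @@ DD ^^^ k @@ dyck_avoiding S) =
      fps_X ^ k * ?P ^ (k + 1)"
    by (simp_all add: conc_assoc power_mult_distrib mult_ac)
qed

text \<open>\<open>S\<close> is a progression with difference \<open>A\<close> and first term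
  \<open>B\<close>, so shifting it by \<open>A\<close> loses exactly \<open>B\<close>. Lengths below
  \<open>A\<close> are all allowed because \<open>A \<le> B\<close>.\<close>

lemma allowed_lengths_shift:
  fixes A B :: nat
  assumes "1 \<le> A" "A \<le> B" and S: "S = {A * r + B | r. r \<ge> 0}"
  shows "insert B ({1..} - S) = {1..<A} \<union> insert A ((+) A ` ({1..} - S))"
proof (rule set_eqI)
  fix k
  have shift: "j \<in> S \<longleftrightarrow> A + j \<in> S \<and> A + j \<noteq> B" if "1 \<le> j" for j
  proof
    assume "j \<in> S"
    then obtain r where r: "j = A * r + B" using S by auto
    then have "A + j = A * Suc r + B" by simp
    then have "A + j \<in> S" unfolding S by blast
    with r assms(1) show "A + j \<in> S \<and> A + j \<noteq> B" by simp
  next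
    assume *: "A + j \<in> S \<and> A + j \<noteq> B"
    then obtain r where r: "A + j = A * r + B" using S by auto
    with * obtain q where "r = Suc q" by (cases r) auto
    with r have "j = A * q + B" by simp
    then show "j \<in> S" unfolding S by blast
  qed
  consider "k = 0" | "1 \<le> k" "k < A" | "k = A" | j where "1 \<le> j" "k = A + j"
    by (metis less_one linorder_neqE_nat linorder_not_le less_imp_add_positive Suc_leI One_nat_def)
  then show "k \<in> insert B ({1..} - S) \<longleftrightarrow>
      k \<in> {1..<A} \<union> insert A ((+) A ` ({1..} - S))"
  proof cases
    case 4
    with shift[of j] show ?thesis by auto
  next
    case 3
    \<comment> \<open>Thus \<open>A\<close> is either allowed or equal to the inserted
      \<open>B\<close>.\<close>
    have "A = B" if "A \<in> S" using that assms S by auto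
    with 3 assms(1) show ?thesis by auto
  qed (use assms S in auto)
qed

theorem proposition10:
  fixes A B :: nat and \<P> :: "word set" and P :: "int fps"
  assumes "1 \<le> A" and "A \<le> B"
    and "\<P> = dyck_avoiding {A * r + B | r. r \<ge> 0}"
    and "P = weight_enum \<P>"
  shows "\<P> \<union> (UU @@ \<P>) ^^^ (B - 1) @@ UU @@ DD ^^^ B @@ \<P> =
           {[]} \<union> (\<Union>k\<in>{1..<A}. (UU @@ \<P>) ^^^ (k - 1) @@ UU @@ DD ^^^ k @@ \<P>)
             \<union> (UU @@ \<P>) ^^^ A @@ DD ^^^ A @@ \<P>
         \<and> P + fps_X ^ B * P ^ B =
           1 + (\<Sum>k\<in>{1..<A}. fps_X ^ k * P ^ k) + fps_X ^ A * P ^ (A + 1)"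
proof -
  define S where "S = {A * r + B | r. r \<ge> 0}"
  define T where "T k = arch S k @@ \<P>" for k
  have P: "\<P> = dyck_avoiding S" using assms(3) by (simp add: S_def)
  have B: "1 \<le> B" using assms(1,2) by simp
  have "B = A * 0 + B" by simp
  then have "B \<in> S" unfolding S_def by blast
  have T: "(UU @@ \<P>) ^^^ (k - 1) @@ UU @@ DD ^^^ k @@ \<P> = T k" for k
    by (simp add: T_def arch_conc P)
  let ?Q = "(UU @@ \<P>) ^^^ A @@ DD ^^^ A @@ \<P>"
  have Q: "?Q = T A \<union> (\<Union>j\<in>{1..} - S. T (A + j))"
    using up_pow_down_pow_eq[OF assms(1), of S \<P>] by (simp add: P T_def)
  have first: "\<P> = {[]} \<union> (\<Union>k\<in>{1..} - S. T k)"
    using dyck_avoiding_first[of S] by (simp add: P T_def)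
  have "\<P> \<union> T B = {[]} \<union> (\<Union>k\<in>insert B ({1..} - S). T k)"
    by (subst first) auto
  also have "\<dots> = {[]} \<union> (\<Union>k\<in>{1..<A}. T k) \<union> ?Q"
    unfolding allowed_lengths_shift[OF assms(1,2) S_def] Q by auto
  finally have lang: "\<P> \<union> T B = {[]} \<union> (\<Union>k\<in>{1..<A}. T k) \<union> ?Q" .
  have disj: "T k \<inter> T j = {}" if "1 \<le> k" "1 \<le> j" "k \<noteq> j" for k j
    using arch_conc_disjoint that by (simp add: T_def)
  have Nil: "[] \<notin> T k" for k by (simp add: T_def Nil_notin_arch_conc)
  have Tenum: "up_finite (T k)" "up_enum (T k) = fps_X ^ k * P ^ k" if "1 \<le> k" for k
    using arch_conc_enum[OF that, of S] by (simp_all add: T_def P assms(4))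
  \<comment> \<open>As \<open>B\<close> is forbidden, \<open>T B\<close> is not among the pieces of
    the first-arch decomposition, so the union on the left is disjoint.\<close>
  have "T k \<inter> T B = {}" if "k \<in> {1..} - S" for k
    using that \<open>B \<in> S\<close> B by (intro disj) auto
  then have "\<P> \<inter> T B = {}"
    using Nil[of B] by (subst first) blast
  then have lhs: "up_enum (\<P> \<union> T B) = P + fps_X ^ B * P ^ B"
    using up_enum_Un(2)[of \<P> "T B"] Tenum[OF B]
    by (simp add: P up_finite_dyck_avoiding up_enum_dyck_avoiding assms(4))
  have Un: "up_finite (\<Union>k\<in>{1..<A}. T k) \<and>
      up_enum (\<Union>k\<in>{1..<A}. T k) = (\<Sum>k\<in>{1..<A}. up_enum (T k))"
    by (intro up_enum_UN disj Tenum) auto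
  have disj1: "{[]} \<inter> (\<Union>k\<in>{1..<A}. T k) = {}" using Nil by auto
  \<comment> \<open>Every arch index occurring in \<open>?Q\<close> is at least
    \<open>A\<close>.\<close>
  have "T k \<inter> T A = {}" "T k \<inter> T (A + j) = {}" if "k \<in> {1..<A}" for k j
    using that assms(1) disj[of k A] disj[of k "A + j"] by simp_all
  then have disj2: "({[]} \<union> (\<Union>k\<in>{1..<A}. T k)) \<inter> ?Q = {}"
    unfolding Q using Nil by blast
  note fin = up_enum_Un[OF up_finite_singleton Un[THEN conjunct1] disj1]
  \<comment> \<open>\<open>?Q\<close> is counted as a concatenation, which avoids summing over its
    infinitely many pieces.\<close>
  have Qenum: "up_finite ?Q" "up_enum ?Q = fps_X ^ A * P ^ (A + 1)"
    using up_pow_down_pow_enum[OF assms(1), of S] by (simp_all add: P assms(4))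
  have "up_enum ({[]} \<union> (\<Union>k\<in>{1..<A}. T k) \<union> ?Q) =
      1 + (\<Sum>k\<in>{1..<A}. fps_X ^ k * P ^ k) + fps_X ^ A * P ^ (A + 1)"
    using up_enum_Un(2)[OF fin(1) Qenum(1) disj2] fin(2) Qenum(2) Un Tenum(2)
    by (simp add: up_enum_singleton)
  with lhs lang show ?thesis by (simp only: T)
qed

end
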